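(* Let $(A,+)$, $(B,+)$, $(C,+)$ be abelian groups, and let $f : A \to B$ and $g : B \to C$ be functions with $\operatorname{Fdeg}(f) < \infty$ and $\operatorname{Fdeg}(g) < \infty$. Then $$\operatorname{Fdeg}(g \circ f) \le \operatorname{Fdeg}(g) \cdot \operatorname{Fdeg}(f).$$
   Context: $\mathbb{N}_0$ is the set of nonnegative integers; abelian groups are written additively. For an abelian group $A$, $\mathbb{Z}[A]$ is the integral group ring; its elements are written as finite sums $\sum_{a\in A} z_a \tau_a$ with $z_a \in \mathbb{Z}$, and $\tau_a \cdot \tau_b = \tau_{a+b}$. The augmentation ideal $\operatorname{Aug}(\mathbb{Z}[A])$ is the ideal of $\mathbb{Z}[A]$ generated by $\{\tau_a - 1 \mid a \in A\}$. For an ideal $I$, $I^0 = \mathbb{Z}[A]$ and $I^n$ is the ideal generated by all products $i_1\cdots i_n$ with $i_1,\ldots,i_n \in I$. For an abelian group $B$, the ring $\mathbb{Z}[A]$ acts on the group $B^A$ of all functions $f : A \to B$ by $((\sum_{a} z_a \tau_a) * f)(x) = \sum_{a} z_a f(x+a)$. For an ideal $J$, $J * f = 0$ means $j * f = 0$ for all $j \in J$. Functional degree: for a function $f : A \to B$ between abelian groups and $I := \operatorname{Aug}(\mathbb{Z}[A])$, $\operatorname{Fdeg}(f) := \min\{ n \in \mathbb{N}_0 \mid I^{n+1} * f = 0\}$, with $\operatorname{Fdeg}(f) = \infty$ if no such $n$ exists. *)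

theory Defs
  imports "HOL-Library.Poly_Mapping" "HOL-Library.Extended_Nat"
begin

text \<open>
  Abelian groups are types of class \<^class>\<open>ab_group_add\<close>. For such a type \<open>'a\<close>, the type
  \<open>'a \<Rightarrow>\<^sub>0 int\<close> of finitely supported functions, whose multiplication is convolution,
  is the integral group ring of \<open>'a\<close>.
\<close>

type_synonym 'a group_ring = "'a \<Rightarrow>\<^sub>0 int"

definition tau :: "'a::ab_group_add \<Rightarrow> 'a group_ring"
  where "tau a = Poly_Mapping.single a 1"

lemma tau_mult: "tau a * tau b = tau (a + b)"
  by (simp add: tau_def mult_single)

lemma tau_zero: "tau 0 = 1"
  by (simp add: tau_def)

lemma group_ring_expansion:
  "p = (\<Sum>a\<in>Poly_Mapping.keys p. of_int (Poly_Mapping.lookup p a) * tau a)"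
proof -
  have "of_int z * tau a = Poly_Mapping.single a z" for z and a :: 'a
    unfolding tau_def
  proof (induct z)
    case (nonneg n)
    show ?case
      by (simp add: mult_single flip: single_of_nat)
  next
    case (neg n)
    have "(of_int (- int (Suc n)) :: 'a group_ring) = - of_nat (Suc n)"
      by (simp only: of_int_minus of_int_of_nat_eq)
    also have "\<dots> = Poly_Mapping.single 0 (- int (Suc n))"
      by (simp only: single_uminus single_of_nat of_nat_id flip: single_of_nat)
    finally show ?case
      by (simp only: mult_single) simp
  qed
  then show ?thesis
    by (intro poly_mapping_eqI) (auto simp: lookup_sum lookup_single when_def in_keys_iff)
qed

text \<open>Ideals of a commutative ring are its submodules as a module over itself.\<close>

lemma module_mult: "module ((*) :: 'r \<Rightarrow> 'r \<Rightarrow> 'r::comm_ring_1)"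
  by standard (simp_all add: algebra_simps)

definition ideal_gen :: "'r::comm_ring_1 set \<Rightarrow> 'r set"
  where "ideal_gen S = module.span (*) S"

lemma ideal_gen_hull: "ideal_gen S = module.subspace (*) hull S"
  unfolding ideal_gen_def by (rule module.span_def[OF module_mult])

definition ideal_pow :: "'r::comm_ring_1 set \<Rightarrow> nat \<Rightarrow> 'r set"
  where "ideal_pow I n = ideal_gen {\<Prod>k<n. i k | i. \<forall>k<n. i k \<in> I}"

text \<open>For exponent \<open>0\<close> the only product is the empty one, so the ideal is the whole ring.\<close>

lemma ideal_pow_0: "ideal_pow I 0 = UNIV"
proof -
  have "x \<in> module.span (*) {1}" for x :: 'a
    using module.span_scale[OF module_mult module.span_base[OF module_mult, of 1 "{1}"], of x]
    by simp
  then show ?thesis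
    by (auto simp: ideal_pow_def ideal_gen_def)
qed

definition aug_ideal :: "'a::ab_group_add group_ring set"
  where "aug_ideal = ideal_gen {tau a - 1 | a. True}"

definition int_mult :: "int \<Rightarrow> 'b \<Rightarrow> 'b::ab_group_add"
  where "int_mult z b =
    (if 0 \<le> z then (\<Sum>_\<in>{..<nat z}. b) else - (\<Sum>_\<in>{..<nat (- z)}. b))"

definition act :: "'a::ab_group_add group_ring \<Rightarrow> ('a \<Rightarrow> 'b::ab_group_add) \<Rightarrow> 'a \<Rightarrow> 'b"
  where "act p f = (\<lambda>x. \<Sum>a\<in>Poly_Mapping.keys p. int_mult (Poly_Mapping.lookup p a) (f (x + a)))"

definition annihilates ::
    "'a::ab_group_add group_ring set \<Rightarrow> ('a \<Rightarrow> 'b::ab_group_add) \<Rightarrow> bool"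
  where "annihilates J f \<longleftrightarrow> (\<forall>j\<in>J. act j f = (\<lambda>_. 0))"

definition Fdeg :: "('a::ab_group_add \<Rightarrow> 'b::ab_group_add) \<Rightarrow> enat"
  where "Fdeg f =
    (if \<exists>n. annihilates (ideal_pow aug_ideal (n + 1)) f
     then enat (LEAST n. annihilates (ideal_pow aug_ideal (n + 1)) f)
     else \<infinity>)"

end

theory Submission
  imports Defs
begin

text \<open>
  Write \<open>\<Delta> a F\<close> for the difference \<open>F (x + a) - F x\<close> and \<open>I\<close> for the augmentation ideal of the group
  ring of \<open>B\<close>. Since \<open>\<Delta> a F = (\<tau>\<^sub>a - 1) * F\<close>, a function has degree at most \<open>n\<close> iff all its
  differences of order \<open>n + 1\<close> vanish. Lift \<open>f\<close> to \<open>x \<mapsto> \<tau>\<^bsub>f x\<^esub>\<close>, with values in the group ring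
  of \<open>B\<close>, so that \<open>g \<circ> f\<close> is the image of the lift under the additive map \<open>p \<mapsto> (p * g) 0\<close>.
  If \<open>f\<close> has degree at most \<open>n \<ge> 1\<close>, then every difference of order \<open>j\<close> of the lift takes values in
  \<open>I\<close> to the power \<open>\<lceil>j / n\<rceil>\<close>; this follows by induction from the Leibniz rule and
  \<open>\<Delta> a \<tau>\<^sub>f = \<tau>\<^sub>f \<cdot> (\<tau>\<^bsub>\<Delta> a f\<^esub> - 1)\<close>, giving weight \<open>k\<close> to \<open>\<tau>\<^sub>h - 1\<close> when \<open>h\<close> has
  degree at most \<open>n - k\<close>. For \<open>j = m n + 1\<close> the power is \<open>m + 1\<close>, which annihilates every \<open>g\<close> of
  degree at most \<open>m\<close>.
\<close>

subsection \<open>Powers of ideals\<close>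

interpretation ring_module: module "(*) :: 'r \<Rightarrow> 'r \<Rightarrow> 'r::comm_ring_1"
  by (rule module_mult)

lemma subspace_ideal_pow: "ring_module.subspace (ideal_pow I n)"
  by (simp add: ideal_pow_def ideal_gen_def)

lemmas ideal_pow_zero_mem = ring_module.subspace_0[OF subspace_ideal_pow]
  and ideal_pow_add = ring_module.subspace_add[OF subspace_ideal_pow]
  and ideal_pow_scale = ring_module.subspace_scale[OF subspace_ideal_pow]

lemma ideal_gen_induct [consumes 1, case_names gen zero add scale]:
  assumes "x \<in> ideal_gen S"
    and "\<And>s. s \<in> S \<Longrightarrow> P s" and "P 0"
    and "\<And>x y. P x \<Longrightarrow> P y \<Longrightarrow> P (x + y)" and "\<And>c x. P x \<Longrightarrow> P (c * x)"
  shows "P x"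
  using assms(1) unfolding ideal_gen_def
proof (induction rule: ring_module.span_induct)
  case base
  show ?case by (auto simp: ring_module.subspace_def assms)
next
  case (step x)
  then show ?case by (rule assms)
qed

lemma prod_mem_ideal_pow: "\<forall>k<n. i k \<in> I \<Longrightarrow> (\<Prod>k<n. i k) \<in> ideal_pow I n"
  unfolding ideal_pow_def ideal_gen_def by (auto intro!: ring_module.span_base)

lemma ideal_pow_induct [consumes 1, case_names prod zero add scale]:
  assumes "x \<in> ideal_pow I n"
    and "\<And>i. \<forall>k<n. i k \<in> I \<Longrightarrow> P (\<Prod>k<n. i k)" and "P 0"
    and "\<And>x y. P x \<Longrightarrow> P y \<Longrightarrow> P (x + y)" and "\<And>c x. P x \<Longrightarrow> P (c * x)"
  shows "P x"
  using assms(1) unfolding ideal_pow_def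
  by (induction rule: ideal_gen_induct) (use assms(2-) in auto)

lemma prod_lessThan_add:
  fixes i :: "nat \<Rightarrow> 'r::comm_monoid_mult"
  shows "(\<Prod>k<m + n. i k) = (\<Prod>k<m. i k) * (\<Prod>k<n. i (m + k))"
  by (induction n) (simp_all add: mult.assoc)

lemma ideal_pow_mult:
  assumes "x \<in> ideal_pow I m" and "y \<in> ideal_pow I n"
  shows "x * y \<in> ideal_pow I (m + n)"
  using assms(1)
proof (induction rule: ideal_pow_induct)
  case (prod i)
  show ?case
    using assms(2)
  proof (induction rule: ideal_pow_induct)
    case (prod j)
    define l where "l k = (if k < m then i k else j (k - m))" for k
    have "(\<Prod>k<m. i k) * (\<Prod>k<n. j k) = (\<Prod>k<m + n. l k)"
      unfolding prod_lessThan_add by (simp add: l_def)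
    moreover have "\<forall>k<m + n. l k \<in> I"
      using prod \<open>\<forall>k<m. i k \<in> I\<close> by (auto simp: l_def)
    ultimately show ?case
      by (simp add: prod_mem_ideal_pow)
  next
    case (scale c y)
    then show ?case
      using ideal_pow_scale[of "(\<Prod>k<m. i k) * y" I "m + n" c] by (simp only: mult.left_commute)
  qed (simp_all add: distrib_left ideal_pow_zero_mem ideal_pow_add)
next
  case (scale c x)
  then show ?case
    using ideal_pow_scale[of "x * y" I "m + n" c] by (simp only: mult.assoc)
qed (simp_all add: distrib_right ideal_pow_zero_mem ideal_pow_add)

lemma ideal_pow_antimono:
  assumes "m \<le> n"
  shows "ideal_pow I n \<subseteq> ideal_pow I m"
proof
  fix x assume "x \<in> ideal_pow I n"
  then show "x \<in> ideal_pow I m"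
  proof (induction rule: ideal_pow_induct)
    case (prod i)
    \<comment> \<open>The surplus \<open>n - m\<close> factors are absorbed as a ring
      coefficient.\<close>
    have "(\<Prod>k<n. i k) = (\<Prod>k<n - m. i (m + k)) * (\<Prod>k<m. i k)"
      using prod_lessThan_add[of i m "n - m"] assms by (simp add: mult.commute)
    then show ?case
      using prod assms by (auto intro!: ideal_pow_scale prod_mem_ideal_pow)
  qed (auto intro: ideal_pow_zero_mem ideal_pow_add ideal_pow_scale)
qed

lemma ideal_pow_1_base: "x \<in> I \<Longrightarrow> x \<in> ideal_pow I 1"
  using prod_mem_ideal_pow[of 1 "\<lambda>_. x" I] by simp

subsection \<open>The action of the group ring on functions\<close>

lemma int_mult_of_nat: "int_mult (int n) b = (\<Sum>_<n. b)"
  by (simp add: int_mult_def)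

lemma int_mult_minus: "int_mult (- z) b = - int_mult z b"
  by (auto simp: int_mult_def)

lemma int_mult_0 [simp]: "int_mult 0 b = 0"
  by (simp add: int_mult_def)

lemma int_mult_1 [simp]: "int_mult 1 b = b"
  using int_mult_of_nat[of 1] by simp

lemma int_mult_add_1: "int_mult (z + 1) b = int_mult z b + b"
proof (cases "z \<ge> 0")
  case True
  then obtain n where "z = int n"
    using nonneg_int_cases by auto
  then show ?thesis
    using int_mult_of_nat[of "Suc n" b] int_mult_of_nat[of n b] by (simp add: add.commute)
next
  case False
  then obtain n where "z = - int (Suc n)"
    by (metis not_le negD)
  moreover from this have "z + 1 = - int n"
    by simp
  ultimately have "int_mult z b = - (\<Sum>_<Suc n. b)" and "int_mult (z + 1) b = - (\<Sum>_<n. b)"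
    by (simp_all only: int_mult_minus int_mult_of_nat)
  then show ?thesis
    by simp
qed

lemma int_mult_add: "int_mult (y + z) b = int_mult y b + int_mult z b"
proof (induction y rule: int_induct[where k = 0])
  case (step1 y)
  then show ?case
    using int_mult_add_1[of "y + z" b] int_mult_add_1[of y b] by (simp add: algebra_simps)
next
  case (step2 y)
  then show ?case
    using int_mult_add_1[of "y - 1 + z" b] int_mult_add_1[of "y - 1" b] by (simp add: algebra_simps)
qed simp

lemma act_superset:
  assumes "finite K" and "Poly_Mapping.keys p \<subseteq> K"
  shows "act p f x = (\<Sum>a\<in>K. int_mult (Poly_Mapping.lookup p a) (f (x + a)))"
  unfolding act_def using assms
  by (intro sum.mono_neutral_left) (auto simp: in_keys_iff)

lemma act_add: "act (p + q) f x = act p f x + act q f x"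
proof -
  let ?K = "Poly_Mapping.keys p \<union> Poly_Mapping.keys q"
  \<comment> \<open>Padding with zero coefficients brings all three sums to the common index set
    \<open>?K\<close>.\<close>
  have "act r f x = (\<Sum>a\<in>?K. int_mult (Poly_Mapping.lookup r a) (f (x + a)))"
    if "r \<in> {p, q, p + q}" for r
    using that keys_add[of p q] by (intro act_superset) auto
  then show ?thesis
    by (simp add: lookup_add int_mult_add sum.distrib)
qed

lemma act_zero [simp]: "act 0 f x = 0"
  by (simp add: act_def)

lemma act_minus: "act (- p) f x = - act p f x"
  using act_add[of p "- p" f x] by (simp add: eq_neg_iff_add_eq_0 add.commute)

lemma act_diff: "act (p - q) f x = act p f x - act q f x"
  using act_add[of p "- q" f x] by (simp add: act_minus)

lemma act_tau [simp]: "act (tau a) f x = f (x + a)"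
  by (simp add: act_def tau_def)

lemma act_one [simp]: "act 1 f x = f x"
  using act_tau[of 0 f x] by (simp add: tau_zero)

text \<open>Every element is an integer combination of the \<open>tau a\<close>, so statements
  additive in the ring element need checking only on these.\<close>

lemma group_ring_induct [case_names zero tau add minus]:
  assumes "P 0" and "\<And>a. P (tau a)"
    and "\<And>p q. P p \<Longrightarrow> P q \<Longrightarrow> P (p + q)" and "\<And>p. P p \<Longrightarrow> P (- p)"
  shows "P p"
proof -
  have diff: "P (p - q)" if "P p" "P q" for p q
    using assms(3)[OF that(1) assms(4)[OF that(2)]] by simp
  have "P (of_int z * tau a)" for z a
    by (induction z rule: int_induct[where k = 0])
      (auto simp: assms algebra_simps intro: diff)
  then have "P (\<Sum>a\<in>K. of_int (Poly_Mapping.lookup p a) * tau a)" for K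
    by (induction K rule: infinite_finite_induct) (auto intro: assms)
  then show ?thesis
    using group_ring_expansion[of p] by metis
qed

text \<open>Additivity reduces \<open>p\<close> to some \<open>tau a\<close>, then \<open>q\<close>
  to some \<open>tau b\<close>, where both sides shift the argument by \<open>a + b\<close>.\<close>

lemma act_mult: "act (p * q) f x = act p (act q f) x"
proof (induction p rule: group_ring_induct)
  case (tau a)
  show ?case
    by (induction q rule: group_ring_induct)
      (simp_all add: tau_mult act_add act_minus algebra_simps)
qed (simp_all add: act_add act_minus algebra_simps)

lemma act_zero_right: "act p (\<lambda>_. 0) x = 0"
  by (induction p rule: group_ring_induct) (simp_all add: act_add act_minus)

lemma act_mult_eq_zero: "\<forall>x. act q f x = 0 \<Longrightarrow> act (p * q) f x = 0"
  by (metis act_mult act_zero_right ext)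

subsection \<open>Differences\<close>

definition fdiff :: "'a::ab_group_add \<Rightarrow> ('a \<Rightarrow> 'b::ab_group_add) \<Rightarrow> 'a \<Rightarrow> 'b"
  where "fdiff a F = (\<lambda>x. F (x + a) - F x)"

lemma act_tau_minus_1: "act (tau a - 1) f = fdiff a f"
  by (simp add: fdiff_def fun_eq_iff act_diff)

lemma annihilates_ideal_pow_mono:
  "annihilates (ideal_pow I m) f \<Longrightarrow> m \<le> n \<Longrightarrow> annihilates (ideal_pow I n) f"
  unfolding annihilates_def by (meson ideal_pow_antimono subsetD)

lemma annihilates_ideal_pow_0: "annihilates (ideal_pow I 0) f \<longleftrightarrow> f = (\<lambda>_. 0)"
  unfolding annihilates_def ideal_pow_0
  by (metis UNIV_I act_one act_zero_right ext)

lemma tau_minus_1_mem: "tau a - 1 \<in> aug_ideal"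
  unfolding aug_ideal_def ideal_gen_def by (rule ring_module.span_base) auto

text \<open>Acting by \<open>p * (tau a - 1)\<close> is acting by \<open>p\<close> on
  \<open>fdiff a f\<close>. Such products lie in the next power; conversely, the last of
  \<open>Suc n\<close> factors is split off and reduced to generators of the augmentation
  ideal.\<close>

lemma annihilates_ideal_pow_Suc:
  fixes f :: "'a::ab_group_add \<Rightarrow> 'b::ab_group_add"
  shows "annihilates (ideal_pow aug_ideal (Suc n)) f
    \<longleftrightarrow> (\<forall>a. annihilates (ideal_pow aug_ideal n) (fdiff a f))"
proof safe
  fix a
  assume ann: "annihilates (ideal_pow aug_ideal (Suc n)) f"
  show "annihilates (ideal_pow aug_ideal n) (fdiff a f)"
    unfolding annihilates_def
  proof
    fix p :: "'a group_ring"
    assume "p \<in> ideal_pow aug_ideal n"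
    then have "p * (tau a - 1) \<in> ideal_pow aug_ideal (Suc n)"
      using ideal_pow_mult[OF _ ideal_pow_1_base[OF tau_minus_1_mem]] by simp
    then show "act p (fdiff a f) = (\<lambda>_. 0)"
      using ann by (auto simp: annihilates_def act_mult act_tau_minus_1 fun_eq_iff)
  qed
next
  assume ann: "\<forall>a. annihilates (ideal_pow aug_ideal n) (fdiff a f)"
  \<comment> \<open>With \<open>p\<close> quantified inside the induction, a coefficient
    \<open>c\<close> of \<open>q\<close> can be moved into \<open>p\<close>.\<close>
  have gen: "\<forall>p\<in>ideal_pow aug_ideal n. \<forall>x. act (p * q) f x = 0" if "q \<in> aug_ideal" for q
    using that[unfolded aug_ideal_def]
  proof (induction rule: ideal_gen_induct)
    case (gen s)
    then show ?case
      using ann by (auto simp: annihilates_def act_mult act_tau_minus_1)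
  next
    case (scale c q)
    show ?case
    proof (intro ballI allI)
      fix p :: "'a group_ring" and x
      assume "p \<in> ideal_pow aug_ideal n"
      then have "act ((c * p) * q) f x = 0"
        using scale ideal_pow_scale by blast
      then show "act (p * (c * q)) f x = 0"
        by (simp only: ac_simps)
    qed
  qed (auto simp: distrib_left act_add)
  have "act p f = (\<lambda>_. 0)" if "p \<in> ideal_pow aug_ideal (Suc n)" for p
    using that
  proof (induction rule: ideal_pow_induct)
    case (prod i)
    then show ?case
      using gen[of "i n"] prod_mem_ideal_pow[of n i aug_ideal] by (simp add: fun_eq_iff)
  qed (simp_all add: fun_eq_iff act_add act_mult_eq_zero)
  then show "annihilates (ideal_pow aug_ideal (Suc n)) f"
    by (auto simp: annihilates_def)
qed

subsection \<open>Filtered functions\<close>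

text \<open>All differences of order \<open>i \<le> j\<close> take values in \<open>L (w + i)\<close>.\<close>

primrec filtered ::
    "(nat \<Rightarrow> 'r::ab_group_add set) \<Rightarrow> nat \<Rightarrow> nat \<Rightarrow> ('a::ab_group_add \<Rightarrow> 'r) \<Rightarrow> bool"
  where
    "filtered L 0 w F \<longleftrightarrow> (\<forall>x. F x \<in> L w)"
  | "filtered L (Suc j) w F \<longleftrightarrow> (\<forall>x. F x \<in> L w) \<and> (\<forall>a. filtered L j (Suc w) (fdiff a F))"

lemma filtered_SucD: "filtered L (Suc j) w F \<Longrightarrow> filtered L j w F"
proof (induction j arbitrary: w F)
  case (Suc j)
  from Suc.prems have "F x \<in> L w" and "filtered L (Suc j) (Suc w) (fdiff a F)" for x a
    by (simp_all only: filtered.simps(2)[of L "Suc j"])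
  then show ?case
    using Suc.IH by (simp only: filtered.simps) blast
qed simp

lemma fdiff_shift: "fdiff b (\<lambda>x. F (x + a)) = (\<lambda>x. fdiff b F (x + a))"
  by (simp add: fdiff_def fun_eq_iff algebra_simps)

lemma filtered_shift: "filtered L j w F \<Longrightarrow> filtered L j w (\<lambda>x. F (x + a))"
proof (induction j arbitrary: w F)
  case (Suc j)
  from Suc.prems have "F x \<in> L w" and "filtered L j (Suc w) (fdiff b F)" for x b
    by simp_all
  with Suc.IH show ?case
    by (simp only: filtered.simps fdiff_shift[of _ F] simp_thms)
qed simp

lemma filtered_zero: "(\<And>w. 0 \<in> L w) \<Longrightarrow> filtered L j w (\<lambda>_. 0)"
  by (induction j arbitrary: w) (auto simp: fdiff_def)

lemma filtered_add:
  assumes "\<And>w x y. x \<in> L w \<Longrightarrow> y \<in> L w \<Longrightarrow> x + y \<in> L w"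
    and "filtered L j w F" and "filtered L j w G"
  shows "filtered L j w (\<lambda>x. F x + G x)"
  using assms(2,3)
proof (induction j arbitrary: w F G)
  case (Suc j)
  have "fdiff a (\<lambda>x. F x + G x) = (\<lambda>x. fdiff a F x + fdiff a G x)" for a
    by (simp add: fdiff_def fun_eq_iff)
  then show ?case
    using Suc by (auto intro: assms(1))
qed (auto intro: assms(1))

text \<open>By the Leibniz rule each difference falls on one factor, raising its weight and hence
  the total by one.\<close>

lemma filtered_mult:
  fixes F G :: "'a::ab_group_add \<Rightarrow> 'r::comm_ring_1"
  assumes add: "\<And>w x y. x \<in> L w \<Longrightarrow> y \<in> L w \<Longrightarrow> x + y \<in> L w"
    and mult: "\<And>v w x y. x \<in> L v \<Longrightarrow> y \<in> L w \<Longrightarrow> x * y \<in> L (v + w)"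
    and "filtered L j v F" and "filtered L j w G"
  shows "filtered L j (v + w) (\<lambda>x. F x * G x)"
  using assms(3,4)
proof (induction j arbitrary: v w F G)
  case (Suc j)
  have "filtered L j (Suc (v + w)) (fdiff a (\<lambda>x. F x * G x))" for a
  proof -
    have "filtered L j (Suc v + w) (\<lambda>x. fdiff a F x * G (x + a))"
      using Suc.prems(1) by (intro Suc.IH filtered_shift filtered_SucD[OF Suc.prems(2)]) simp
    moreover have "filtered L j (v + Suc w) (\<lambda>x. F x * fdiff a G x)"
      using Suc.prems(2) by (intro Suc.IH filtered_SucD[OF Suc.prems(1)]) simp
    moreover have "fdiff a (\<lambda>x. F x * G x) = (\<lambda>x. fdiff a F x * G (x + a) + F x * fdiff a G x)"
      by (simp add: fdiff_def fun_eq_iff algebra_simps)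
    ultimately show ?thesis
      by (simp add: filtered_add[OF add])
  qed
  then show ?case
    using Suc.prems by (auto intro: mult)
qed (auto intro: mult)

text \<open>Acting on \<open>g\<close> is additive in the ring element, so it commutes with
  differences; those of order \<open>j\<close> of \<open>F\<close> lie in \<open>L (w + j)\<close>,
  which kills \<open>g\<close>.\<close>

lemma annihilates_filtered:
  assumes "filtered L j w F" and "\<And>p. p \<in> L (w + j) \<Longrightarrow> act p g = (\<lambda>_. 0)"
  shows "annihilates (ideal_pow aug_ideal j) (\<lambda>x. act (F x) g y)"
  using assms
proof (induction j arbitrary: w F)
  case 0
  then show ?case
    by (simp add: annihilates_ideal_pow_0 fun_eq_iff)
next
  case (Suc j)
  have "fdiff a (\<lambda>x. act (F x) g y) = (\<lambda>x. act (fdiff a F x) g y)" for a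
    by (simp add: fdiff_def fun_eq_iff act_diff)
  then show ?case
    using Suc.IH[of "Suc w"] Suc.prems by (simp add: annihilates_ideal_pow_Suc)
qed

subsection \<open>Functional degree of a composition\<close>

text \<open>The exponent is the ceiling of \<open>w / n\<close>.\<close>

definition weight_ideal :: "nat \<Rightarrow> nat \<Rightarrow> 'a::ab_group_add group_ring set"
  where "weight_ideal n w = ideal_pow aug_ideal ((w + n - 1) div n)"

lemma weight_ideal_add:
  "x \<in> weight_ideal n w \<Longrightarrow> y \<in> weight_ideal n w \<Longrightarrow> x + y \<in> weight_ideal n w"
  unfolding weight_ideal_def by (rule ideal_pow_add)

lemma weight_ideal_zero_mem: "0 \<in> weight_ideal n w"
  unfolding weight_ideal_def by (rule ideal_pow_zero_mem)

lemma weight_ideal_0: "n > 0 \<Longrightarrow> weight_ideal n 0 = UNIV"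
  by (simp add: weight_ideal_def ideal_pow_0)

text \<open>This adjunction turns comparisons of rounded-up quotients into comparisons of
  products.\<close>

lemma ceil_div_le_iff:
  fixes n w k :: nat
  assumes "n > 0"
  shows "(w + n - 1) div n \<le> k \<longleftrightarrow> w \<le> k * n"
proof -
  have "(w + n - 1) div n \<le> k \<longleftrightarrow> (w + n - 1) div n < Suc k"
    by auto
  also have "\<dots> \<longleftrightarrow> w + n - 1 < Suc k * n"
    using assms by (rule div_less_iff_less_mult)
  also have "\<dots> \<longleftrightarrow> w \<le> k * n"
    using assms by auto
  finally show ?thesis .
qed

lemma weight_ideal_mult:
  assumes "n > 0" and "x \<in> weight_ideal n v" and "y \<in> weight_ideal n w"
  shows "x * y \<in> weight_ideal n (v + w)"
proof -
  let ?c = "\<lambda>w. (w + n - 1) div n"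
  have "v \<le> ?c v * n" "w \<le> ?c w * n"
    using ceil_div_le_iff[OF assms(1)] by blast+
  \<comment> \<open>The ceiling is subadditive, and a smaller exponent gives a larger ideal.\<close>
  then have "?c (v + w) \<le> ?c v + ?c w"
    by (simp only: ceil_div_le_iff[OF assms(1)] distrib_right add_mono)
  then show ?thesis
    using ideal_pow_antimono ideal_pow_mult assms(2,3) unfolding weight_ideal_def by blast
qed

lemma fdiff_tau: "fdiff a (\<lambda>x. tau (f x)) = (\<lambda>x. tau (f x) * (tau (fdiff a f x) - 1))"
  by (simp add: fdiff_def right_diff_distrib tau_mult)

text \<open>The claims need each other: a difference of the lift is the lift times
  \<open>tau h - 1\<close> with \<open>h = fdiff a f\<close>. Differencing \<open>f\<close> lowers
  \<open>d\<close> by one and raises \<open>k\<close> by one, keeping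
  \<open>d + k = Suc n\<close>.\<close>

lemma filtered_tau:
  fixes f :: "'a::ab_group_add \<Rightarrow> 'b::ab_group_add"
  assumes "n > 0"
  shows "annihilates (ideal_pow aug_ideal (Suc n)) f \<Longrightarrow>
      filtered (weight_ideal n) j 0 (\<lambda>x. tau (f x))"
    and "annihilates (ideal_pow aug_ideal d) f \<Longrightarrow> d + k = Suc n \<Longrightarrow> k > 0 \<Longrightarrow>
      filtered (weight_ideal n) j k (\<lambda>x. tau (f x) - 1)"
proof (induction j arbitrary: f d k)
  case 0
  {
    case 1
    show ?case
      using assms by (simp add: weight_ideal_0)
  next
    case 2
    \<comment> \<open>For \<open>d = 0\<close> the function \<open>tau (f x) - 1\<close> vanishes;
      for \<open>d > 0\<close> the balance gives \<open>k \<le> n\<close>, so lying in the first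
      power suffices.\<close>
    show ?case
    proof (cases d)
      case 0
      with 2 show ?thesis
        by (auto simp: annihilates_ideal_pow_0 tau_zero weight_ideal_zero_mem)
    next
      case (Suc e)
      with 2 have "(k + n - 1) div n \<le> 1"
        by (subst ceil_div_le_iff[OF assms]) auto
      then show ?thesis
        using ideal_pow_antimono ideal_pow_1_base[OF tau_minus_1_mem]
        unfolding weight_ideal_def filtered.simps by blast
    qed
  }
next
  case (Suc j)
  have step: "filtered (weight_ideal n) j (Suc k) (fdiff a (\<lambda>x. tau (h x)))"
    if "annihilates (ideal_pow aug_ideal (Suc n)) h"
      and "annihilates (ideal_pow aug_ideal d) (fdiff a h)" and "d + k = n"
    for h :: "'a \<Rightarrow> 'b" and a d k
  proof -
    \<comment> \<open>The lift has weight 0 and the other factor weight \<open>Suc k\<close>,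
      because \<open>d + Suc k = Suc n\<close>.\<close>
    have "filtered (weight_ideal n) j (0 + Suc k) (\<lambda>x. tau (h x) * (tau (fdiff a h x) - 1))"
    proof (rule filtered_mult)
      show "filtered (weight_ideal n) j 0 (\<lambda>x. tau (h x))"
        by (rule Suc.IH(1)) (rule that)
      show "filtered (weight_ideal n) j (Suc k) (\<lambda>x. tau (fdiff a h x) - 1)"
        using that(3) by (intro Suc.IH(2)[OF that(2)]) simp_all
    qed (auto intro: weight_ideal_add weight_ideal_mult[OF assms])
    then show ?thesis
      by (simp add: fdiff_tau)
  qed
  {
    case 1
    have "filtered (weight_ideal n) j (Suc 0) (fdiff a (\<lambda>x. tau (f x)))" for a
      using 1 by (intro step[of f n]) (simp_all add: annihilates_ideal_pow_Suc[of n])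
    then show ?case
      using assms by (simp add: weight_ideal_0)
  next
    case 2
    have ann: "annihilates (ideal_pow aug_ideal (Suc n)) f"
      using 2 by (intro annihilates_ideal_pow_mono[OF 2(1)]) simp
    show ?case
    proof (cases d)
      case 0
      with 2 show ?thesis
        by (simp add: annihilates_ideal_pow_0 tau_zero weight_ideal_zero_mem filtered_zero
            del: filtered.simps)
    next
      case (Suc e)
      with 2 have "(k + n - 1) div n \<le> 1"
        by (subst ceil_div_le_iff[OF assms]) auto
      then have "tau (f x) - 1 \<in> weight_ideal n k" for x
        using ideal_pow_antimono ideal_pow_1_base[OF tau_minus_1_mem]
        unfolding weight_ideal_def by blast
      \<comment> \<open>The constant 1 drops out of differences, so \<open>step\<close>
        applies.\<close>
      moreover have "fdiff a (\<lambda>x. tau (f x) - 1) = fdiff a (\<lambda>x. tau (f x))" for a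
        by (simp add: fdiff_def)
      moreover have "filtered (weight_ideal n) j (Suc k) (fdiff a (\<lambda>x. tau (f x)))" for a
        using 2 ann unfolding Suc annihilates_ideal_pow_Suc[of e] by (intro step[of f e]) simp_all
      ultimately show ?thesis
        by simp
    qed
  }
qed

lemma annihilates_comp:
  fixes f :: "'a::ab_group_add \<Rightarrow> 'b::ab_group_add" and g :: "'b \<Rightarrow> 'c::ab_group_add"
  assumes f: "annihilates (ideal_pow aug_ideal (Suc n)) f"
    and g: "annihilates (ideal_pow aug_ideal (Suc m)) g"
  shows "annihilates (ideal_pow aug_ideal (Suc (m * n))) (g \<circ> f)"
\<comment> \<open>The weights divide by \<open>n\<close>, so \<open>n = 0\<close> is separate: there
  \<open>f\<close>, hence also the composition, is constant.\<close>
proof (cases "n = 0")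
  case True
  with f have "f (x + a) = f x" for x a
    by (auto simp: annihilates_ideal_pow_Suc annihilates_ideal_pow_0 fdiff_def fun_eq_iff)
  with True show ?thesis
    by (simp add: annihilates_ideal_pow_Suc annihilates_ideal_pow_0 fdiff_def)
next
  case False
  \<comment> \<open>Since \<open>m * n + 1\<close> exceeds \<open>m * n\<close>, its quotient by
    \<open>n\<close>, rounded up, exceeds \<open>m\<close>.\<close>
  then have "Suc m \<le> (Suc (m * n) + n - 1) div n"
    using ceil_div_le_iff[of n "Suc (m * n)" m] by auto
  then have "act p g = (\<lambda>_. 0)" if "p \<in> weight_ideal n (0 + Suc (m * n))" for p
    using annihilates_ideal_pow_mono[OF g] that unfolding annihilates_def weight_ideal_def by simp
  \<comment> \<open>Evaluation at 0 recovers the composition: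
    \<open>act (tau (f x)) g 0 = g (0 + f x)\<close>.\<close>
  then have "annihilates (ideal_pow aug_ideal (Suc (m * n))) (\<lambda>x. act (tau (f x)) g 0)"
    using False by (intro annihilates_filtered[OF filtered_tau(1)[OF _ f]]) auto
  then show ?thesis
    by (simp add: comp_def)
qed

lemma Fdeg_finiteE:
  assumes "Fdeg f < \<infinity>"
  obtains n where "Fdeg f = enat n" and "annihilates (ideal_pow aug_ideal (Suc n)) f"
proof -
  let ?P = "\<lambda>n. annihilates (ideal_pow aug_ideal (n + 1)) f"
  \<comment> \<open>An empty set of bounds would give the default value \<infinity>.\<close>
  have ex: "\<exists>n. ?P n"
    by (rule ccontr) (use assms in \<open>simp add: Fdeg_def\<close>)
  have "Fdeg f = enat (LEAST n. ?P n)"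
    unfolding Fdeg_def by (rule if_P[OF ex])
  moreover have "?P (LEAST n. ?P n)"
    using ex by (rule LeastI_ex)
  ultimately show ?thesis
    using that by simp
qed

lemma Fdeg_le: "annihilates (ideal_pow aug_ideal (Suc n)) f \<Longrightarrow> Fdeg f \<le> enat n"
  by (auto simp: Fdeg_def intro: Least_le)

theorem theorem4p2:
  fixes f :: "'a::ab_group_add \<Rightarrow> 'b::ab_group_add"
    and g :: "'b \<Rightarrow> 'c::ab_group_add"
  assumes "Fdeg f < \<infinity>" and "Fdeg g < \<infinity>"
  shows "Fdeg (g \<circ> f) \<le> Fdeg g * Fdeg f"
proof -
  obtain m n where "Fdeg g = enat m" "annihilates (ideal_pow aug_ideal (Suc m)) g"
    and "Fdeg f = enat n" "annihilates (ideal_pow aug_ideal (Suc n)) f"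
    using assms by (meson Fdeg_finiteE)
  then show ?thesis
    using Fdeg_le[OF annihilates_comp] by simp
qed

end
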